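(* For the Prism allied graph $\mathbb{D}^{t}_{n}$ with $n\ge 4$, the independent mixed metric number of $\mathbb{D}^{t}_{n}$ equals $n+1$.
   Context: For an integer $n\ge 3$, the Prism allied graph $\mathbb{D}^{t}_{n}$ has vertex set $\{p_i,q_i,r_i,s_i : 1\le i\le n\}$ and edge set $\{p_iq_i,\ p_ip_{i+1},\ q_iq_{i+1},\ r_iq_i,\ r_iq_{i+1},\ r_is_i : 1\le i\le n\}$, with indices taken modulo $n$. For a connected graph $H$, $d_H(u,v)$ is the shortest-path distance, and for a vertex $x$ and an edge $e=uv$, $d_H(x,e)=\min\{d_H(x,u),d_H(x,v)\}$. A set $M\subseteq V(H)$ is a mixed metric generator of $H$ if for every two distinct elements $y_1,y_2\in V(H)\cup E(H)$ there is a vertex $z\in M$ with $d_H(z,y_1)\ne d_H(z,y_2)$. An independent mixed metric generator is a mixed metric generator that is an independent set (no two of its vertices are adjacent); the independent mixed metric number of $H$ is the minimum cardinality of an independent mixed metric generator of $H$. *)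

theory Defs
  imports Main "HOL-Library.Extended_Nat"
begin

text \<open>A simple graph is given by its vertex set \<open>V\<close> and its set \<open>E\<close> of edges, each edge
  being a two-element set of vertices.\<close>

definition graph_path :: "'a set \<Rightarrow> 'a set set \<Rightarrow> 'a list \<Rightarrow> bool" where
  "graph_path V E xs \<longleftrightarrow> xs \<noteq> [] \<and> set xs \<subseteq> V \<and> distinct xs \<and>
     (\<forall>i. Suc i < length xs \<longrightarrow> {xs ! i, xs ! Suc i} \<in> E)"

text \<open>The distances are extended naturals, so vertices not joined by a path are at distance
  \<open>\<infinity>\<close>; this does not occur in a connected graph.\<close>

definition graph_dist :: "'a set \<Rightarrow> 'a set set \<Rightarrow> 'a \<Rightarrow> 'a \<Rightarrow> enat" where
  "graph_dist V E u v =
     (INF xs \<in> {xs. graph_path V E xs \<and> hd xs = u \<and> last xs = v}. enat (length xs - 1))"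

definition edge_dist :: "'a set \<Rightarrow> 'a set set \<Rightarrow> 'a \<Rightarrow> 'a set \<Rightarrow> enat" where
  "edge_dist V E x e = Min (graph_dist V E x ` e)"

text \<open>The elements of \<open>V(H) \<union> E(H)\<close> are represented in the disjoint sum \<open>V <+> E\<close>.\<close>

definition elem_dist :: "'a set \<Rightarrow> 'a set set \<Rightarrow> 'a \<Rightarrow> 'a + 'a set \<Rightarrow> enat" where
  "elem_dist V E x y = (case y of Inl v \<Rightarrow> graph_dist V E x v | Inr e \<Rightarrow> edge_dist V E x e)"

definition mixed_metric_generator :: "'a set \<Rightarrow> 'a set set \<Rightarrow> 'a set \<Rightarrow> bool" where
  "mixed_metric_generator V E M \<longleftrightarrow> M \<subseteq> V \<and>
     (\<forall>y1 \<in> V <+> E. \<forall>y2 \<in> V <+> E. y1 \<noteq> y2 \<longrightarrow>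
        (\<exists>z \<in> M. elem_dist V E z y1 \<noteq> elem_dist V E z y2))"

definition independent_vertices :: "'a set set \<Rightarrow> 'a set \<Rightarrow> bool" where
  "independent_vertices E M \<longleftrightarrow> (\<forall>u \<in> M. \<forall>v \<in> M. {u, v} \<notin> E)"

definition independent_mixed_metric_generator :: "'a set \<Rightarrow> 'a set set \<Rightarrow> 'a set \<Rightarrow> bool" where
  "independent_mixed_metric_generator V E M \<longleftrightarrow>
     mixed_metric_generator V E M \<and> independent_vertices E M"

text \<open>For finite \<open>V\<close> this is the minimum, and it is \<open>\<infinity>\<close> if there is no independent
  mixed metric generator.\<close>

definition independent_mixed_metric_number :: "'a set \<Rightarrow> 'a set set \<Rightarrow> enat" where
  "independent_mixed_metric_number V E =
     (INF M \<in> {M. independent_mixed_metric_generator V E M}. enat (card M))"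

datatype prism_vertex = P nat | Q nat | R nat | S nat

definition prism_allied_verts :: "nat \<Rightarrow> prism_vertex set" where
  "prism_allied_verts n = (\<Union>i \<in> {1..n}. {P i, Q i, R i, S i})"

text \<open>On the index set \<open>{1..n}\<close>, the cyclic successor of \<open>i\<close> is \<open>i mod n + 1\<close>.\<close>

definition prism_allied_edges :: "nat \<Rightarrow> prism_vertex set set" where
  "prism_allied_edges n = (\<Union>i \<in> {1..n}.
     {{P i, Q i}, {P i, P (i mod n + 1)}, {Q i, Q (i mod n + 1)},
      {R i, Q i}, {R i, Q (i mod n + 1)}, {R i, S i}})"

end

theory Submission
  imports Defs
begin

text \<open>Only the pendant vertex \<open>S i\<close> can distinguish \<open>R i\<close> from the edge \<open>{R i, S i}\<close>, so every
  generator contains all \<open>S i\<close>. These do not suffice, since each \<open>S j\<close> is nearer to \<open>Q i\<close> than to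
  \<open>P i\<close> and hence does not distinguish \<open>Q i\<close> from \<open>{P i, Q i}\<close>. Conversely, for \<open>n \<ge> 4\<close> these are
  the only pairs that the \<open>S j\<close> leave unresolved: every other pair is told apart by the balls of
  radius at most 3 around the \<open>S j\<close>. The single vertex \<open>P 1\<close> is nearer to each \<open>P i\<close> than to
  \<open>Q i\<close>, so it resolves all these remaining pairs at once.\<close>

section \<open>Distances in graphs\<close>

text \<open>A finite infimum of extended naturals is attained, so a bound by \<open>k\<close>
  amounts to a path with at most \<open>k\<close> edges.\<close>

lemma graph_dist_le_iff:
  "graph_dist V E x v \<le> enat k \<longleftrightarrow>
     (\<exists>xs. graph_path V E xs \<and> hd xs = x \<and> last xs = v \<and> length xs \<le> Suc k)"
proof
  assume le: "graph_dist V E x v \<le> enat k"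
  show "\<exists>xs. graph_path V E xs \<and> hd xs = x \<and> last xs = v \<and> length xs \<le> Suc k"
  proof (rule ccontr)
    assume "\<not> ?thesis"
    then have "enat (Suc k) \<le> graph_dist V E x v"
      unfolding graph_dist_def by (intro INF_greatest) fastforce
    with le have "enat (Suc k) \<le> enat k" by (rule order_trans[rotated])
    then show False by simp
  qed
next
  assume "\<exists>xs. graph_path V E xs \<and> hd xs = x \<and> last xs = v \<and> length xs \<le> Suc k"
  then obtain xs where "graph_path V E xs" "hd xs = x" "last xs = v" "length xs \<le> Suc k"
    by blast
  then have "graph_dist V E x v \<le> enat (length xs - 1)" "length xs - 1 \<le> k"
    unfolding graph_dist_def by (auto intro!: INF_lower)
  then show "graph_dist V E x v \<le> enat k"
    by (meson enat_ord_simps(1) order_trans)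
qed

lemma graph_dist_self:
  assumes "x \<in> V"
  shows "graph_dist V E x x = 0"
proof -
  have "graph_dist V E x x \<le> enat 0"
    unfolding graph_dist_le_iff using assms
    by (intro exI[of _ "[x]"]) (simp add: graph_path_def)
  then show ?thesis by (simp add: zero_enat_def[symmetric])
qed

lemma graph_dist_eq_0_iff:
  assumes "x \<in> V"
  shows "graph_dist V E x v = 0 \<longleftrightarrow> v = x"
proof
  assume "graph_dist V E x v = 0"
  then have "graph_dist V E x v \<le> enat 0" by (simp add: zero_enat_def)
  then obtain xs where "graph_path V E xs" "hd xs = x" "last xs = v" "length xs \<le> Suc 0"
    unfolding graph_dist_le_iff by blast
  then show "v = x" by (cases xs) (auto simp: graph_path_def)
qed (use assms graph_dist_self in simp)

lemma graph_path_take: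
  assumes "graph_path V E xs" "0 < m"
  shows "graph_path V E (take m xs)"
  using assms set_take_subset[of m xs] by (auto simp: graph_path_def)

lemma graph_path_snoc:
  assumes "graph_path V E xs" "v \<in> V" "v \<notin> set xs" "{last xs, v} \<in> E"
  shows "graph_path V E (xs @ [v])"
proof -
  have "{(xs @ [v]) ! i, (xs @ [v]) ! Suc i} \<in> E" if "Suc i < length (xs @ [v])" for i
  proof (cases "Suc i < length xs")
    case True
    then show ?thesis using assms(1) by (simp add: graph_path_def nth_append)
  next
    case False
    then have "i = length xs - 1" "xs \<noteq> []" using that assms(1) by (auto simp: graph_path_def)
    then show ?thesis using assms(4) by (simp add: nth_append last_conv_nth)
  qed
  then show ?thesis using assms by (simp add: graph_path_def)
qed

text \<open>A shortest path to \<open>u\<close> is extended by \<open>v\<close>. If it already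
  visits \<open>v\<close>, distinctness forbids this, and it is cut off at \<open>v\<close>
  instead.\<close>

lemma graph_dist_step:
  assumes "v \<in> V" "{u, v} \<in> E"
  shows "graph_dist V E x v \<le> eSuc (graph_dist V E x u)"
proof (cases "graph_dist V E x u")
  case (enat k)
  then obtain xs where xs: "graph_path V E xs" "hd xs = x" "last xs = u" "length xs \<le> Suc k"
    using graph_dist_le_iff[of V E x u k] by auto
  have "\<exists>ys. graph_path V E ys \<and> hd ys = x \<and> last ys = v \<and> length ys \<le> Suc (Suc k)"
  proof (cases "v \<in> set xs")
    case True
    then obtain i where i: "i < length xs" "xs ! i = v" by (auto simp: in_set_conv_nth)
    have "graph_path V E (take (Suc i) xs)" using xs(1) by (rule graph_path_take) simp
    moreover have "last (take (Suc i) xs) = v" using i by (simp add: take_Suc_conv_app_nth)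
    ultimately show ?thesis using xs i by (intro exI[of _ "take (Suc i) xs"]) simp
  next
    case False
    then have "graph_path V E (xs @ [v])" using graph_path_snoc xs assms by metis
    then show ?thesis using xs by (intro exI[of _ "xs @ [v]"]) (auto simp: graph_path_def)
  qed
  then have "graph_dist V E x v \<le> enat (Suc k)" by (simp add: graph_dist_le_iff)
  then show ?thesis by (simp add: enat eSuc_enat)
qed simp

text \<open>Along a path from \<open>x\<close> the value of \<open>g\<close> grows by at most one
  per edge. Lower bounds thus reduce to guessing a potential \<open>g\<close> and checking it edge
  by edge.\<close>

lemma graph_dist_ge:
  fixes g :: "'a \<Rightarrow> enat"
  assumes "g x = 0"
    and lip: "\<And>u v. u \<in> V \<Longrightarrow> v \<in> V \<Longrightarrow> {u, v} \<in> E \<Longrightarrow> g v \<le> eSuc (g u)"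
  shows "g v \<le> graph_dist V E x v"
  unfolding graph_dist_def
proof (intro INF_greatest)
  fix xs assume "xs \<in> {xs. graph_path V E xs \<and> hd xs = x \<and> last xs = v}"
  then have xs: "graph_path V E xs" "hd xs = x" "last xs = v" by auto
  then have ne: "xs \<noteq> []" by (simp add: graph_path_def)
  have "i < length xs \<Longrightarrow> g (xs ! i) \<le> enat i" for i
  proof (induction i)
    case 0
    then show ?case using xs(2) ne assms(1) by (simp add: hd_conv_nth)
  next
    case (Suc i)
    then have "g (xs ! Suc i) \<le> eSuc (g (xs ! i))"
      using xs(1) by (intro lip) (auto simp: graph_path_def subset_iff)
    also have "\<dots> \<le> eSuc (enat i)" using Suc by simp
    finally show ?case by (simp add: eSuc_enat)
  qed
  from this[of "length xs - 1"] show "g v \<le> enat (length xs - 1)"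
    using xs(3) ne by (simp add: last_conv_nth)
qed

text \<open>Removing the last edge of a path yields this recursion on the radius, by which the small
  balls around the \<open>S j\<close> are computed later.\<close>

lemma graph_dist_le_Suc_iff:
  assumes "x \<in> V" "v \<in> V"
  shows "graph_dist V E x v \<le> enat (Suc k) \<longleftrightarrow>
     v = x \<or> (\<exists>u\<in>V. {u, v} \<in> E \<and> graph_dist V E x u \<le> enat k)"
proof
  assume "graph_dist V E x v \<le> enat (Suc k)"
  then obtain xs where xs: "graph_path V E xs" "hd xs = x" "last xs = v" "length xs \<le> Suc (Suc k)"
    unfolding graph_dist_le_iff by blast
  show "v = x \<or> (\<exists>u\<in>V. {u, v} \<in> E \<and> graph_dist V E x u \<le> enat k)"
  proof (cases "length xs \<le> 1")
    case True
    then show ?thesis using xs by (cases xs) (auto simp: graph_path_def)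
  next
    case False
    define m where "m = length xs - 2"
    have m: "length xs = Suc (Suc m)" using False by (simp add: m_def)
    have tk: "graph_path V E (take (Suc m) xs)" using xs(1) by (rule graph_path_take) simp
    have la: "last (take (Suc m) xs) = xs ! m" using m by (simp add: take_Suc_conv_app_nth)
    have "graph_dist V E x (xs ! m) \<le> enat k"
      unfolding graph_dist_le_iff using tk la xs m
      by (intro exI[of _ "take (Suc m) xs"]) simp
    moreover have "xs ! m \<in> V" "{xs ! m, xs ! Suc m} \<in> E"
      using xs(1) m by (auto simp: graph_path_def subset_iff)
    moreover have "xs ! Suc m = v" using xs(1,3) m last_conv_nth[of xs] by (simp add: graph_path_def)
    ultimately show ?thesis by auto
  qed
next
  assume "v = x \<or> (\<exists>u\<in>V. {u, v} \<in> E \<and> graph_dist V E x u \<le> enat k)"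
  then show "graph_dist V E x v \<le> enat (Suc k)"
  proof
    assume "v = x"
    then show ?thesis using graph_dist_self[OF assms(1)] by simp
  next
    assume "\<exists>u\<in>V. {u, v} \<in> E \<and> graph_dist V E x u \<le> enat k"
    then obtain u where u: "{u, v} \<in> E" "graph_dist V E x u \<le> enat k" by blast
    have "graph_dist V E x v \<le> eSuc (graph_dist V E x u)" using assms(2) u(1) by (rule graph_dist_step)
    also have "\<dots> \<le> eSuc (enat k)" using u(2) by simp
    finally show ?thesis by (simp add: eSuc_enat)
  qed
qed

lemma edge_dist_doubleton:
  "edge_dist V E x {u, v} = min (graph_dist V E x u) (graph_dist V E x v)"
  by (simp add: edge_dist_def)

text \<open>Every path to \<open>w\<close> from elsewhere enters through \<open>u\<close>, so a
  vertex other than \<open>w\<close> cannot separate \<open>u\<close> from the edge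
  \<open>{u, w}\<close>.\<close>

lemma pendant_vertex_in_mixed_metric_generator:
  assumes gen: "mixed_metric_generator V E M"
    and "{u, w} \<in> E" "u \<in> V" "u \<noteq> w"
    and pendant: "\<And>v. {v, w} \<in> E \<Longrightarrow> v = u"
  shows "w \<in> M"
proof (rule ccontr)
  assume "w \<notin> M"
  have "graph_dist V E z u \<le> graph_dist V E z w" if "z \<in> M" for z
  proof -
    \<comment> \<open>Resetting the value at \<open>w\<close> to one more than at \<open>u\<close>
      keeps the function 1-Lipschitz, as \<open>u\<close> is the only neighbour of
      \<open>w\<close>.\<close>
    define g where "g v = (if v = w then eSuc (graph_dist V E z u) else graph_dist V E z v)" for v
    have "z \<noteq> w" "z \<in> V"
      using that \<open>w \<notin> M\<close> gen by (auto simp: mixed_metric_generator_def)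
    have "g v \<le> eSuc (g v')" if "v' \<in> V" "v \<in> V" "{v', v} \<in> E" for v v'
    proof (cases "v = w")
      case True
      then show ?thesis using pendant[of v'] that \<open>u \<noteq> w\<close> by (simp add: g_def)
    next
      case False
      show ?thesis
      proof (cases "v' = w")
        case True
        then have "v = u" using pendant[of v] that(3) by (simp add: insert_commute)
        then have "g v' = eSuc (g v)" using True \<open>u \<noteq> w\<close> by (simp add: g_def)
        then show ?thesis by (metis ile_eSuc order_trans)
      next
        case v': False
        then show ?thesis
          using False graph_dist_step[OF that(2,3)] by (simp add: g_def)
      qed
    qed
    moreover have "g z = 0" using \<open>z \<noteq> w\<close> \<open>z \<in> V\<close> by (simp add: g_def graph_dist_self)
    ultimately have "g w \<le> graph_dist V E z w" by (rule graph_dist_ge[rotated])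
    then show ?thesis by (simp add: g_def) (metis ile_eSuc order_trans)
  qed
  then have "elem_dist V E z (Inl u) = elem_dist V E z (Inr {u, w})" if "z \<in> M" for z
    using that by (simp add: elem_dist_def edge_dist_doubleton min_def)
  then show False
    using gen \<open>u \<in> V\<close> \<open>{u, w} \<in> E\<close> unfolding mixed_metric_generator_def by blast
qed

section \<open>The prism allied graph\<close>

context
  fixes n :: nat
  assumes n: "n \<ge> 4"
begin

section \<open>Cyclic index arithmetic\<close>

definition I :: "nat set" where "I = {1..n}"
definition nxt :: "nat \<Rightarrow> nat" where "nxt i = i mod n + 1"
text \<open>A case split, since truncated subtraction yields 0 at \<open>i = 1\<close>, outside
  \<open>{1..n}\<close>.\<close>

definition prv :: "nat \<Rightarrow> nat" where "prv i = (if i = 1 then n else i - 1)"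

abbreviation (input) "VV \<equiv> prism_allied_verts n"
abbreviation (input) "EE \<equiv> prism_allied_edges n"
abbreviation (input) "d \<equiv> graph_dist VV EE"

lemma nxt_eq: "i \<in> I \<Longrightarrow> nxt i = (if i = n then 1 else i + 1)"
  by (auto simp: nxt_def I_def)

lemma nxt_in [simp]: "i \<in> I \<Longrightarrow> nxt i \<in> I"
  using n by (auto simp: nxt_eq) (auto simp: I_def)

lemma prv_in [simp]: "i \<in> I \<Longrightarrow> prv i \<in> I"
  using n by (auto simp: prv_def I_def)

lemma nxt_prv [simp]: "i \<in> I \<Longrightarrow> nxt (prv i) = i"
  by (subst nxt_eq, simp) (auto simp: prv_def I_def)

lemma prv_nxt [simp]: "i \<in> I \<Longrightarrow> prv (nxt i) = i"
  by (auto simp: nxt_eq prv_def I_def)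

text \<open>Here \<open>n \<ge> 4\<close> is essential: one, two or three forward steps cannot close
  up.\<close>

lemma nxt_neq:
  assumes "i \<in> I"
  shows "nxt i \<noteq> i" "nxt (nxt i) \<noteq> i" "nxt (nxt (nxt i)) \<noteq> i"
proof -
  have i: "nxt i \<in> I" "nxt (nxt i) \<in> I" using assms by auto
  show "nxt i \<noteq> i" "nxt (nxt i) \<noteq> i" "nxt (nxt (nxt i)) \<noteq> i"
    using n nxt_eq[OF assms] nxt_eq[OF i(1)] nxt_eq[OF i(2)] by (auto split: if_splits)
qed

lemma prv_neq:
  assumes "i \<in> I"
  shows "prv i \<noteq> i" "prv i \<noteq> nxt i" "prv (prv i) \<noteq> i" "prv (prv i) \<noteq> nxt i"
    "nxt (nxt i) \<noteq> prv i"
  using nxt_neq(1)[of "prv i"] nxt_neq(2)[of "prv i"] nxt_neq(2)[of "prv (prv i)"]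
    nxt_neq(3)[of "prv (prv i)"] nxt_neq(3)[of "prv i"] assms
  by auto

lemma prv_pair_inj:
  assumes "i \<in> I" "j \<in> I"
  shows "{prv i, i} = {prv j, j} \<longleftrightarrow> i = j"
  using prv_neq[OF assms(2)] by (auto simp: doubleton_eq_iff)

text \<open>The centre \<open>i\<close> lies in the triple around \<open>j\<close>. Were it one step
  off, its own triple would contain an index two steps from \<open>j\<close>, which is outside the
  triple around \<open>j\<close> on a cycle of at least four indices.\<close>

lemma prv_nxt_triple_inj:
  assumes "i \<in> I" "j \<in> I"
  shows "{prv i, i, nxt i} = {prv j, j, nxt j} \<longleftrightarrow> i = j"
proof
  assume eq: "{prv i, i, nxt i} = {prv j, j, nxt j}"
  then have "i \<in> {prv j, j, nxt j}" by auto
  moreover have "i \<noteq> prv j"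
  proof
    assume "i = prv j"
    then have "prv (prv j) \<in> {prv j, j, nxt j}" using eq by auto
    then show False using prv_neq[OF assms(2)] prv_neq(1)[of "prv j"] assms by auto
  qed
  moreover have "i \<noteq> nxt j"
  proof
    assume "i = nxt j"
    then have "nxt (nxt j) \<in> {prv j, j, nxt j}" using eq by auto
    then show False
      using prv_neq[OF assms(2)] nxt_neq[OF assms(2)] nxt_neq(1)[of "nxt j"] assms by auto
  qed
  ultimately show "i = j" by auto
qed simp

lemma pair_neq_triple:
  assumes "i \<in> I" "j \<in> I"
  shows "{prv i, i} \<noteq> {prv j, j, nxt j}"
proof
  assume "{prv i, i} = {prv j, j, nxt j}"
  moreover have "card {prv j, j, nxt j} = 3"
    using nxt_neq[OF assms(2)] prv_neq[OF assms(2)] by simp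
  moreover have "card {prv i, i} = 2" using prv_neq[OF assms(1)] by simp
  ultimately show False by simp
qed

text \<open>The size of the set, two or three, gives the flag, and then its members give the
  index.\<close>

lemma pair_or_triple_inj:
  assumes "i \<in> I" "j \<in> I"
    and "(if b then {prv i, i, nxt i} else {prv i, i}) =
      (if b' then {prv j, j, nxt j} else {prv j, j})"
  shows "i = j \<and> b = b'"
  using assms(3) prv_pair_inj[OF assms(1,2)] prv_nxt_triple_inj[OF assms(1,2)]
    pair_neq_triple[OF assms(1,2)] pair_neq_triple[OF assms(2,1)]
  by (metis (full_types))

section \<open>Vertices, edges and neighbourhoods\<close>

lemma verts_eq: "VV = P ` I \<union> Q ` I \<union> R ` I \<union> S ` I"
  by (auto simp: prism_allied_verts_def I_def)

lemma verts_iff [simp]: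
  "P i \<in> VV \<longleftrightarrow> i \<in> I" "Q i \<in> VV \<longleftrightarrow> i \<in> I" "R i \<in> VV \<longleftrightarrow> i \<in> I" "S i \<in> VV \<longleftrightarrow> i \<in> I"
  by (auto simp: verts_eq)

lemma edges_eq: "EE = (\<Union>i \<in> I.
     {{P i, Q i}, {P i, P (nxt i)}, {Q i, Q (nxt i)}, {R i, Q i}, {R i, Q (nxt i)}, {R i, S i}})"
  by (simp add: prism_allied_edges_def nxt_def I_def)

text \<open>Both orientations of each edge are listed, so that Lipschitz conditions on ordered pairs
  can be checked by cases.\<close>

lemma edges_cases:
  assumes "{u, v} \<in> EE"
  obtains i where "i \<in> I" "(u, v) \<in> {(P i, Q i), (P i, P (nxt i)), (Q i, Q (nxt i)), (R i, Q i),
    (R i, Q (nxt i)), (R i, S i), (Q i, P i), (P (nxt i), P i), (Q (nxt i), Q i), (Q i, R i),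
    (Q (nxt i), R i), (S i, R i)}"
  using assms by (auto simp: edges_eq doubleton_eq_iff)

lemma edgesI:
  assumes "i \<in> I"
  shows "{P i, Q i} \<in> EE" "{P i, P (nxt i)} \<in> EE" "{Q i, Q (nxt i)} \<in> EE"
    "{R i, Q i} \<in> EE" "{R i, Q (nxt i)} \<in> EE" "{R i, S i} \<in> EE"
  using assms by (auto simp: edges_eq)

lemma adj_S: "i \<in> I \<Longrightarrow> {u, S i} \<in> EE \<longleftrightarrow> u = R i"
  by (auto simp: edges_eq doubleton_eq_iff)

lemma adj_R: "i \<in> I \<Longrightarrow> {u, R i} \<in> EE \<longleftrightarrow> u \<in> {Q i, Q (nxt i), S i}"
  by (auto simp: edges_eq doubleton_eq_iff)

lemma adj_Q:
  assumes "i \<in> I"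
  shows "{u, Q i} \<in> EE \<longleftrightarrow> u \<in> {P i, Q (nxt i), Q (prv i), R i, R (prv i)}"
proof
  assume "{u, Q i} \<in> EE"
  then show "u \<in> {P i, Q (nxt i), Q (prv i), R i, R (prv i)}"
    by (rule edges_cases) auto
next
  assume "u \<in> {P i, Q (nxt i), Q (prv i), R i, R (prv i)}"
  then show "{u, Q i} \<in> EE"
    using edgesI[OF assms] edgesI[of "prv i"] assms by (auto simp: insert_commute)
qed

lemma adj_P:
  assumes "i \<in> I"
  shows "{u, P i} \<in> EE \<longleftrightarrow> u \<in> {Q i, P (nxt i), P (prv i)}"
proof
  assume "{u, P i} \<in> EE"
  then show "u \<in> {Q i, P (nxt i), P (prv i)}"
    by (rule edges_cases) auto
next
  assume "u \<in> {Q i, P (nxt i), P (prv i)}"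
  then show "{u, P i} \<in> EE"
    using edgesI[OF assms] edgesI[of "prv i"] assms by (auto simp: insert_commute)
qed

lemmas adj = adj_S adj_R adj_Q adj_P

section \<open>Distances from the pendant vertices and from \<open>P 1\<close>\<close>

lemma dist_S_le_0:
  assumes "j \<in> I"
  shows "d (S j) v \<le> enat 0 \<longleftrightarrow> v = S j"
  using graph_dist_eq_0_iff[of "S j" VV EE v] assms by (simp add: zero_enat_def[symmetric])

text \<open>The ball recursion with the four kinds of neighbourhood filled in. The disjunct for the
  centre survives only for \<open>S i\<close>, because the centre is \<open>S j\<close>.\<close>

lemma dist_S_le_Suc:
  assumes "j \<in> I" "i \<in> I"
  shows "d (S j) (S i) \<le> enat (Suc k) \<longleftrightarrow> j = i \<or> d (S j) (R i) \<le> enat k" (is ?S)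
    "d (S j) (R i) \<le> enat (Suc k) \<longleftrightarrow> d (S j) (Q i) \<le> enat k \<or> d (S j) (Q (nxt i)) \<le> enat k
      \<or> d (S j) (S i) \<le> enat k" (is ?R)
    "d (S j) (Q i) \<le> enat (Suc k) \<longleftrightarrow> d (S j) (P i) \<le> enat k \<or> d (S j) (Q (nxt i)) \<le> enat k
      \<or> d (S j) (Q (prv i)) \<le> enat k \<or> d (S j) (R i) \<le> enat k \<or> d (S j) (R (prv i)) \<le> enat k" (is ?Q)
    "d (S j) (P i) \<le> enat (Suc k) \<longleftrightarrow> d (S j) (Q i) \<le> enat k \<or> d (S j) (P (nxt i)) \<le> enat k
      \<or> d (S j) (P (prv i)) \<le> enat k" (is ?P)
proof -
  have *: "d (S j) v \<le> enat (Suc k) \<longleftrightarrow> v = S j \<or> (\<exists>u\<in>N. d (S j) u \<le> enat k)"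
    if "v \<in> VV" "N \<subseteq> VV" "\<And>u. {u, v} \<in> EE \<longleftrightarrow> u \<in> N" for v N
    unfolding graph_dist_le_Suc_iff[OF verts_iff(4)[THEN iffD2, OF assms(1)] that(1)]
    using that(2,3) by blast
  show ?S
    using *[of "S i" "{R i}"] assms adj_S by auto
  show ?R
    by (subst *[OF _ _ adj_R]) (use assms in auto)
  show ?Q
    by (subst *[OF _ _ adj_Q]) (use assms in auto)
  show ?P
    by (subst *[OF _ _ adj_P]) (use assms in auto)
qed

lemma dist_S_le_1:
  assumes "j \<in> I" "i \<in> I"
  shows "d (S j) (S i) \<le> enat (Suc 0) \<longleftrightarrow> j = i" "d (S j) (R i) \<le> enat (Suc 0) \<longleftrightarrow> j = i"
    "\<not> d (S j) (Q i) \<le> enat (Suc 0)" "\<not> d (S j) (P i) \<le> enat (Suc 0)"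
  using assms by (auto simp: dist_S_le_Suc[where k = 0] dist_S_le_0)

lemma dist_S_le_2:
  assumes "j \<in> I" "i \<in> I"
  shows "d (S j) (S i) \<le> enat (Suc (Suc 0)) \<longleftrightarrow> j = i"
    "d (S j) (R i) \<le> enat (Suc (Suc 0)) \<longleftrightarrow> j = i"
    "d (S j) (Q i) \<le> enat (Suc (Suc 0)) \<longleftrightarrow> j = prv i \<or> j = i"
    "\<not> d (S j) (P i) \<le> enat (Suc (Suc 0))"
  using assms by (auto simp: dist_S_le_Suc[where k = "Suc 0"] dist_S_le_1)

lemma dist_S_le_3:
  assumes "j \<in> I" "i \<in> I"
  shows "d (S j) (S i) \<le> enat (Suc (Suc (Suc 0))) \<longleftrightarrow> j = i"
    "d (S j) (R i) \<le> enat (Suc (Suc (Suc 0))) \<longleftrightarrow> j = prv i \<or> j = i \<or> j = nxt i"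
    "d (S j) (P i) \<le> enat (Suc (Suc (Suc 0))) \<longleftrightarrow> j = prv i \<or> j = i"
  using assms by (auto simp: dist_S_le_Suc[where k = "Suc (Suc 0)"] dist_S_le_2)

text \<open>Replacing the distance to \<open>P i\<close> by one more than the distance to \<open>Q i\<close> gives a
  1-Lipschitz function, because the \<open>Q\<close>-cycle runs parallel to the \<open>P\<close>-cycle.\<close>

lemma dist_S_P_ge:
  assumes "j \<in> I"
  shows "d (S j) (Q i) \<le> d (S j) (P i)"
proof -
  define g where "g v = (case v of P i \<Rightarrow> eSuc (d (S j) (Q i)) | _ \<Rightarrow> d (S j) v)" for v
  have le: "x \<le> eSuc (eSuc x)" for x
    by (meson ile_eSuc order_trans)
  have "g v \<le> eSuc (g u)" if "{u, v} \<in> EE" for u v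
    using that
    by (rule edges_cases) (auto simp: g_def le adj intro!: graph_dist_step)
  moreover have "g (S j) = 0" using assms by (simp add: g_def graph_dist_self)
  ultimately have "g (P i) \<le> d (S j) (P i)" by (intro graph_dist_ge) auto
  then show ?thesis by (simp add: g_def) (meson ile_eSuc order_trans)
qed

text \<open>Sending \<open>Q i\<close>, \<open>R i\<close> and \<open>S i\<close> to
  \<open>P i\<close> maps each edge to an edge of the \<open>P\<close>-cycle or collapses it, so
  walks do not get longer. The extra 1 pays for leaving the \<open>P\<close>-cycle.\<close>

lemma dist_P_Q_ge:
  assumes "j \<in> I"
  shows "eSuc (d (P j) (P i)) \<le> d (P j) (Q i)"
proof -
  define g where "g v = (case v of P i \<Rightarrow> d (P j) (P i) | Q i \<Rightarrow> eSuc (d (P j) (P i))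
    | R i \<Rightarrow> eSuc (d (P j) (P i)) | S i \<Rightarrow> eSuc (d (P j) (P i)))" for v
  have step: "d (P j) (P k) \<le> eSuc (d (P j) (P (nxt k)))" "d (P j) (P (nxt k)) \<le> eSuc (d (P j) (P k))"
    if "k \<in> I" for k
    using that edgesI(2)[OF that] by (auto intro!: graph_dist_step simp: insert_commute)
  have le: "x \<le> eSuc x" "x \<le> eSuc (eSuc x)" for x
    by (meson ile_eSuc order_trans)+
  have "g v \<le> eSuc (g u)" if "{u, v} \<in> EE" for u v
    using that by (rule edges_cases) (auto simp: g_def step le)
  moreover have "g (P j) = 0" using assms by (simp add: g_def graph_dist_self)
  ultimately have "g (Q i) \<le> d (P j) (Q i)" by (intro graph_dist_ge) auto
  then show ?thesis by (simp add: g_def)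
qed

text \<open>Walking upwards along the \<open>P\<close>-cycle from \<open>P 1\<close> reaches
  \<open>P i\<close>. Finiteness matters because \<open>eSuc\<close> fixes
  \<open>\<infinity>\<close>, so the gap between \<open>P i\<close> and \<open>Q i\<close> is strict
  only at finite distances.\<close>

lemma dist_P_P_finite:
  assumes "i \<in> I"
  shows "d (P 1) (P i) \<noteq> \<infinity>"
proof -
  have "Suc k \<in> I \<Longrightarrow> d (P 1) (P (Suc k)) \<le> enat k" for k
  proof (induction k)
    case 0
    then show ?case by (simp add: graph_dist_self zero_enat_def[symmetric])
  next
    case (Suc k)
    then have k: "Suc k \<in> I" "nxt (Suc k) = Suc (Suc k)" by (auto simp: I_def nxt_def)
    then have "d (P 1) (P (Suc (Suc k))) \<le> eSuc (d (P 1) (P (Suc k)))"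
      using Suc.prems edgesI(2)[of "Suc k"] by (intro graph_dist_step) auto
    also have "\<dots> \<le> eSuc (enat k)" using Suc.IH k by simp
    finally show ?case by (simp add: eSuc_enat)
  qed
  from this[of "i - 1"] show ?thesis using assms
    by (cases "d (P 1) (P i)") (auto simp: I_def)
qed

section \<open>Elements seen from the pendant vertices\<close>

text \<open>Two elements have the same distances from all \<open>S j\<close> exactly when these sets
  agree for every \<open>k\<close>. In this form the minimum over an edge becomes a union.\<close>

definition near :: "nat \<Rightarrow> prism_vertex + prism_vertex set \<Rightarrow> nat set" where
  "near k y = {j \<in> I. elem_dist VV EE (S j) y \<le> enat k}"

lemma near_edge: "near k (Inr {u, v}) = near k (Inl u) \<union> near k (Inl v)"
  by (auto simp: near_def elem_dist_def edge_dist_doubleton min_le_iff_disj)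

lemma near_0:
  assumes "i \<in> I"
  shows "near 0 (Inl (S i)) = {i}" "near 0 (Inl (R i)) = {}" "near 0 (Inl (Q i)) = {}"
    "near 0 (Inl (P i)) = {}"
  using assms by (auto simp: near_def elem_dist_def dist_S_le_0)

lemma near_1:
  assumes "i \<in> I"
  shows "near (Suc 0) (Inl (S i)) = {i}" "near (Suc 0) (Inl (R i)) = {i}"
    "near (Suc 0) (Inl (Q i)) = {}" "near (Suc 0) (Inl (P i)) = {}"
  using assms by (auto simp: near_def elem_dist_def dist_S_le_1)

lemma near_2:
  assumes "i \<in> I"
  shows "near (Suc (Suc 0)) (Inl (S i)) = {i}" "near (Suc (Suc 0)) (Inl (R i)) = {i}"
    "near (Suc (Suc 0)) (Inl (Q i)) = {prv i, i}" "near (Suc (Suc 0)) (Inl (P i)) = {}"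
  using assms by (auto simp: near_def elem_dist_def dist_S_le_2)

lemma near_3:
  assumes "i \<in> I"
  shows "near (Suc (Suc (Suc 0))) (Inl (S i)) = {i}"
    "near (Suc (Suc (Suc 0))) (Inl (R i)) = {prv i, i, nxt i}"
    "near (Suc (Suc (Suc 0))) (Inl (P i)) = {prv i, i}"
  using assms by (auto simp: near_def elem_dist_def dist_S_le_3)

text \<open>The groups are sorted by the least \<open>k\<close> for which \<open>near k y\<close> is
  nonempty: 0, 1, 2 and 3 in this order.\<close>

lemma elems_cases:
  assumes "y \<in> VV <+> EE"
  obtains i where "i \<in> I" "y \<in> {Inl (S i), Inr {R i, S i}}"
  | i where "i \<in> I" "y \<in> {Inl (R i), Inr {R i, Q i}, Inr {R i, Q (nxt i)}}"
  | i where "i \<in> I" "y \<in> {Inl (Q i), Inr {P i, Q i}, Inr {Q i, Q (nxt i)}}"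
  | i where "i \<in> I" "y \<in> {Inl (P i), Inr {P i, P (nxt i)}}"
  using assms by (auto simp: verts_eq edges_eq)

text \<open>The first nonempty set among \<open>near 0 y, near 1 y, \<dots>\<close> reveals the type of \<open>y\<close> up
  to at most three possibilities, and the shape of the next ones reveals the rest.\<close>

lemma near_determines:
  assumes y: "y \<in> VV <+> EE" and y': "y' \<in> VV <+> EE"
    and eq: "\<And>k. near k y = near k y'"
  shows "y = y' \<or> (\<exists>i\<in>I. {y, y'} = {Inl (Q i), Inr {P i, Q i}})"
proof -
  have e: "near 0 y = near 0 y'" "near (Suc 0) y = near (Suc 0) y'"
    "near (Suc (Suc 0)) y = near (Suc (Suc 0)) y'"
    "near (Suc (Suc (Suc 0))) y = near (Suc (Suc (Suc 0))) y'"
    by (rule eq)+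
  note sim = near_edge near_0 near_1 near_2
  from y show ?thesis
  proof (cases rule: elems_cases)
    case (1 i)
    note y_type = 1(2)
    have 0: "near 0 y = {i}" using 1 by (auto simp: sim)
    from y' show ?thesis
    proof (cases rule: elems_cases)
      case (1 j)
      have "near 0 y' = {j}" using 1 by (auto simp: sim)
      then have "i = j" using 0 e(1) by simp
      \<comment> \<open>Radius 3 decides: \<open>S i\<close> yields \<open>{i}\<close>, while the
        edge \<open>{R i, S i}\<close> also yields both neighbouring indices.\<close>
      then show ?thesis
        using 1 y_type e(4) nxt_neq[of i] by (auto simp: near_edge near_3)
    \<comment> \<open>If \<open>y'\<close> belongs to another group, the first radius with a
      nonempty set differs.\<close>
    qed (use 0 e in \<open>auto simp: sim\<close>)
  next
    case (2 i)
    note y_type = 2(2)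
    have 0: "near 0 y = {}" "near (Suc 0) y = {i}" using 2 by (auto simp: sim)
    from y' show ?thesis
    proof (cases rule: elems_cases)
      case (2 j)
      have "near (Suc 0) y' = {j}" using 2 by (auto simp: sim)
      then have "i = j" using 0 e(2) by simp
      \<comment> \<open>At radius 2, \<open>R i\<close> yields only \<open>i\<close>; its edge to
        \<open>Q i\<close> adds \<open>prv i\<close>, and its edge to \<open>Q (nxt i)\<close> adds
        \<open>nxt i\<close>.\<close>
      then show ?thesis
        using 2 y_type e(3) nxt_neq[of i] prv_neq[of i]
        by (auto simp: sim doubleton_eq_iff insert_commute)
    qed (use 0 e in \<open>auto simp: sim\<close>)
  next
    case (3 i)
    note y_type = 3(2)
    have 0: "near 0 y = {}" "near (Suc 0) y = {}" "near (Suc (Suc 0)) y \<noteq> {}"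
      using 3 by (auto simp: sim)
    \<comment> \<open>Only the edge of the \<open>Q\<close>-cycle reaches \<open>nxt i\<close>.
      \<open>Q i\<close> and \<open>{P i, Q i}\<close> yield the same pair, whence the exception in
      the conclusion.\<close>
    have n2: "near (Suc (Suc 0)) y = (if y = Inr {Q i, Q (nxt i)} then {prv i, i, nxt i} else {prv i, i})"
      using 3 by (auto simp: sim doubleton_eq_iff)
    from y' show ?thesis
    proof (cases rule: elems_cases)
      case (3 j)
      have "near (Suc (Suc 0)) y' = (if y' = Inr {Q j, Q (nxt j)} then {prv j, j, nxt j} else {prv j, j})"
        using 3 by (auto simp: sim doubleton_eq_iff)
      then have "i = j \<and> (y = Inr {Q i, Q (nxt i)}) = (y' = Inr {Q j, Q (nxt j)})"
        using n2 e(3) 3(1) \<open>i \<in> I\<close> by (intro pair_or_triple_inj) simp_all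
      then show ?thesis using 3 y_type by (auto simp: insert_commute)
    qed (use 0 e in \<open>auto simp: sim\<close>)
  next
    case (4 i)
    note y_type = 4(2)
    have 0: "near 0 y = {}" "near (Suc 0) y = {}" "near (Suc (Suc 0)) y = {}"
      using 4 by (auto simp: sim)
    have n3: "near (Suc (Suc (Suc 0))) y = (if y \<noteq> Inl (P i) then {prv i, i, nxt i} else {prv i, i})"
      using 4 by (auto simp: near_edge near_3)
    from y' show ?thesis
    proof (cases rule: elems_cases)
      case (4 j)
      have "near (Suc (Suc (Suc 0))) y' = (if y' \<noteq> Inl (P j) then {prv j, j, nxt j} else {prv j, j})"
        using 4 by (auto simp: near_edge near_3)
      then have "i = j \<and> (y \<noteq> Inl (P i)) = (y' \<noteq> Inl (P j))"
        using n3 e(4) 4(1) \<open>i \<in> I\<close> by (intro pair_or_triple_inj) simp_all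
      then show ?thesis using 4 y_type by auto
    qed (use 0 e in \<open>auto simp: sim\<close>)
  qed
qed

section \<open>Upper and lower bound\<close>

lemma card_S: "finite (S ` I)" "card (S ` I) = n"
  by (auto simp: I_def card_image inj_on_def)

lemma one_in: "1 \<in> I"
  using n by (simp add: I_def)

lemma generator_insert_P: "mixed_metric_generator VV EE (insert (P 1) (S ` I))"
  unfolding mixed_metric_generator_def
proof (intro conjI ballI impI)
  show "insert (P 1) (S ` I) \<subseteq> VV" using one_in by auto
next
  fix y y' assume y: "y \<in> VV <+> EE" "y' \<in> VV <+> EE" "y \<noteq> y'"
  show "\<exists>z\<in>insert (P 1) (S ` I). elem_dist VV EE z y \<noteq> elem_dist VV EE z y'"
  proof (rule ccontr)
    assume "\<not> ?thesis"
    then have P: "elem_dist VV EE (P 1) y = elem_dist VV EE (P 1) y'"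
      and "\<And>j. j \<in> I \<Longrightarrow> elem_dist VV EE (S j) y = elem_dist VV EE (S j) y'" by auto
    then have "near k y = near k y'" for k by (auto simp: near_def)
    from near_determines[OF y(1,2) this] y(3)
    obtain i where i: "i \<in> I" "{y, y'} = {Inl (Q i), Inr {P i, Q i}}" by auto
    then have "d (P 1) (Q i) = min (d (P 1) (P i)) (d (P 1) (Q i))"
      using P by (auto simp: doubleton_eq_iff elem_dist_def edge_dist_doubleton)
    \<comment> \<open>Not resolving the pair would place \<open>Q i\<close> no farther from
      \<open>P 1\<close> than \<open>P i\<close>, against the strict gap at finite distance.\<close>
    then have "d (P 1) (Q i) \<le> d (P 1) (P i)" by (metis min.cobounded1)
    with dist_P_Q_ge[OF one_in, of i] have "eSuc (d (P 1) (P i)) \<le> d (P 1) (P i)"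
      by (rule order_trans)
    then show False using dist_P_P_finite[OF i(1)]
      by (cases "d (P 1) (P i)") (auto simp: eSuc_enat)
  qed
qed

text \<open>Independence also tests \<open>u = v\<close>, so a loop at \<open>P 1\<close> must be
  excluded; this is where \<open>nxt 1 \<noteq> 1\<close> enters.\<close>

lemma independent_insert_P: "independent_vertices EE (insert (P 1) (S ` I))"
  using one_in nxt_neq(1)[OF one_in]
  by (auto simp: independent_vertices_def edges_eq doubleton_eq_iff)

lemma generator_card_ge:
  assumes M: "mixed_metric_generator VV EE M"
  shows "n + 1 \<le> card M"
proof -
  have "S i \<in> M" if "i \<in> I" for i
    using that
    by (intro pendant_vertex_in_mixed_metric_generator[OF M, where u = "R i"]) (auto simp: adj_S)
  then have sub: "S ` I \<subseteq> M" by auto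
  have "M \<noteq> S ` I"
  proof
    assume "M = S ` I"
    then have "elem_dist VV EE z (Inl (Q 1)) = elem_dist VV EE z (Inr {P 1, Q 1})" if "z \<in> M" for z
      using that dist_S_P_ge by (auto simp: elem_dist_def edge_dist_doubleton min_absorb2)
    moreover have "Inl (Q 1) \<in> VV <+> EE" "Inr {P 1, Q 1} \<in> VV <+> EE"
      using one_in edgesI(1)[OF one_in] by auto
    ultimately show False using M unfolding mixed_metric_generator_def by blast
  qed
  \<comment> \<open>An infinite set has \<open>card\<close> 0, so strict inclusion gives a strict
    inequality only for finite \<open>M\<close>.\<close>
  moreover have "finite M"
    using M finite_subset[of M VV] by (auto simp: mixed_metric_generator_def prism_allied_verts_def)
  ultimately have "card (S ` I) < card M" using sub by (intro psubset_card_mono) auto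
  then show ?thesis using card_S by simp
qed

end

theorem theorem6:
  fixes n :: nat
  assumes "n \<ge> 4"
  shows "independent_mixed_metric_number (prism_allied_verts n) (prism_allied_edges n)
           = enat (n + 1)"
  unfolding independent_mixed_metric_number_def
proof (rule antisym)
  let ?gens = "{M. independent_mixed_metric_generator (prism_allied_verts n) (prism_allied_edges n) M}"
  have "card (insert (P 1) (S ` I n)) = n + 1"
    using card_S[OF assms] by (subst card_insert_disjoint) auto
  then show "(INF M \<in> ?gens. enat (card M)) \<le> enat (n + 1)"
    using generator_insert_P[OF assms] independent_insert_P[OF assms]
    by (intro INF_lower2[of "insert (P 1) (S ` I n)"])
      (auto simp: independent_mixed_metric_generator_def)
  show "enat (n + 1) \<le> (INF M \<in> ?gens. enat (card M))"
    using generator_card_ge[OF assms]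
    by (intro INF_greatest) (auto simp: independent_mixed_metric_generator_def)
qed

end
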